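(* Let $\alpha\in(0,2)$ and let $p(\cdot)$ be a symmetric transition rate with $p(\cdot)\in\mathrm{DAN}(\alpha)$ and $p(1)>0$. For any $K>0$ there exists a finite constant $\kappa=\kappa(K,p(\cdot))$ such that for any $K$-subpolynomial function $\phi:\mathbb{N}\to[0,\infty)$ and any $n\in\mathbb{N}$, \[ \sum_{z=1}^n q(z)\phi(z)\le\kappa\sum_{z=1}^n p(z)\phi(z), \] where $q(z):=z^{-(1+\alpha)}$.
   Context: $\mathbb{N}=\{1,2,\dots\}$. A transition rate is a non-zero function $p:\mathbb{Z}\to[0,\infty)$ with $p(0)=0$ and $\sum_{z\in\mathbb{Z}}p(z)<\infty$; it is symmetric if $p(z)=p(-z)$ for all $z$. A symmetric transition rate $p$ is in $\mathrm{DAN}(\alpha)$ (domain of normal attraction of an $\alpha$-stable law), $\alpha\in(0,2)$, if there is a constant $c\in(0,\infty)$ with $\lim_{x\to\infty} x^\alpha\sum_{y\ge x}p(y)=c$. A function $\phi:\mathbb{N}\to[0,\infty)$ is called $K$-subpolynomial (with $K$ finite) if $\phi(x+y)\le K(\phi(x)+\phi(y))$ for any $x,y\in\mathbb{N}$. *)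

theory Defs
  imports "HOL-Analysis.Analysis"
begin

definition transition_rate :: "(int \<Rightarrow> real) \<Rightarrow> bool" where
  "transition_rate p \<longleftrightarrow>
     (\<forall>z. 0 \<le> p z) \<and> (\<exists>z. p z \<noteq> 0) \<and> p 0 = 0 \<and> p summable_on UNIV"

definition symmetric_rate :: "(int \<Rightarrow> real) \<Rightarrow> bool" where
  "symmetric_rate p \<longleftrightarrow> (\<forall>z. p z = p (- z))"

text \<open>
  The variable \<open>x\<close> in the tail limit ranges over the reals; the tail sum is over integers
  \<open>y \<ge> x\<close>.
\<close>

definition DAN :: "real \<Rightarrow> (int \<Rightarrow> real) set" where
  "DAN \<alpha> = {p. transition_rate p \<and> symmetric_rate p \<and>
     (\<exists>c>0. ((\<lambda>x::real. x powr \<alpha> * (\<Sum>\<^sub>\<infinity>y\<in>{y::int. x \<le> real_of_int y}. p y))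
                \<longlongrightarrow> c) at_top)}"

text \<open>
  A function on the positive integers is represented by a function on \<^typ>\<open>nat\<close> whose value
  at \<open>0\<close> is unconstrained.
\<close>

definition subpolynomial :: "real \<Rightarrow> (nat \<Rightarrow> real) \<Rightarrow> bool" where
  "subpolynomial K \<phi> \<longleftrightarrow>
     (\<forall>x\<ge>1. 0 \<le> \<phi> x) \<and> (\<forall>x\<ge>1. \<forall>y\<ge>1. \<phi> (x + y) \<le> K * (\<phi> x + \<phi> y))"

definition q :: "real \<Rightarrow> nat \<Rightarrow> real" where
  "q \<alpha> z = real z powr (- (1 + \<alpha>))"

end

theory Submission
  imports Defs
begin

text \<open>
  Average \<open>\<phi> z \<le> K (\<phi> x + \<phi> (z - x))\<close> over \<open>(1 - \<epsilon>) z \<le> x < z\<close> with weights \<open>p x\<close>. Since \<open>p\<close>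
  is in DAN, the total weight is at least of order \<open>\<epsilon> z\<^sup>-\<^sup>\<alpha>\<close> for large \<open>z\<close>. After multiplication by
  \<open>q z\<close> and summation over \<open>z\<close>, the terms \<open>\<phi> x\<close> contribute a multiple of \<open>\<Sum> p \<phi>\<close>, while the terms
  \<open>\<phi> (z - x)\<close> only involve arguments \<open>w = z - x \<le> \<epsilon> z\<close>; exchanging the sums, they contribute at
  most \<open>C \<epsilon>\<^sup>\<alpha> \<Sum> q \<phi>\<close> with \<open>C\<close> independent of \<open>\<epsilon>\<close>. For small \<open>\<epsilon>\<close> this is absorbed into the left-hand
  side. The finitely many small \<open>z\<close> are controlled by \<open>\<phi> 1\<close>, hence by \<open>p 1 \<phi> 1\<close>.
\<close>

section \<open>Tail sums of the rate\<close>

text \<open>The sum in \<open>DAN\<close>, with a real argument because it is evaluated at the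
  non-integer points \<open>(1 - \<epsilon>) * real z\<close> and
  \<open>real w / (2 * \<epsilon>)\<close>.\<close>

definition tail :: "(int \<Rightarrow> real) \<Rightarrow> real \<Rightarrow> real" where
  "tail p x = (\<Sum>\<^sub>\<infinity>y\<in>{y::int. x \<le> real_of_int y}. p y)"

lemma tail_diff:
  assumes "transition_rate p" "0 \<le> x" "x \<le> real z"
  shows "tail p x - tail p (real z) = (\<Sum>y\<in>{y. x \<le> real y \<and> y < z}. p (int y))"
proof -
  let ?A = "{y::nat. x \<le> real y \<and> y < z}"
  have fin: "finite ?A" by auto
  \<comment> \<open>Since \<open>0 \<le> x\<close>, every integer counted by the tail is a natural
    number, so the part below \<open>z\<close> is a finite image under \<open>int\<close>.\<close>
  have split: "{y::int. x \<le> real_of_int y} = int ` ?A \<union> {y. real z \<le> real_of_int y}"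
  proof (intro set_eqI iffI)
    fix y :: int assume "y \<in> {y. x \<le> real_of_int y}"
    then have y: "x \<le> real_of_int y" "0 \<le> y" using assms(2) by auto
    then show "y \<in> int ` ?A \<union> {y. real z \<le> real_of_int y}"
      by (cases "real z \<le> real_of_int y") (auto intro!: image_eqI[of _ _ "nat y"])
  qed (use assms in auto)
  have summ: "p summable_on B" for B
    using assms(1) summable_on_subset_banach[of p UNIV B] by (auto simp: transition_rate_def)
  have "tail p x = infsum p (int ` ?A) + tail p (real z)"
    unfolding tail_def split by (rule infsum_Un_disjoint) (auto intro: summ)
  also have "infsum p (int ` ?A) = (\<Sum>y\<in>?A. p (int y))"
    using fin by (simp add: sum.reindex)
  finally show ?thesis by simp
qed

lemma sum_le_tail:
  assumes "transition_rate p" "finite A" "\<And>y. y \<in> A \<Longrightarrow> x \<le> real y"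
  shows "(\<Sum>y\<in>A. p (int y)) \<le> tail p x"
proof -
  have "(\<Sum>y\<in>A. p (int y)) = sum p (int ` A)"
    by (simp add: sum.reindex)
  also have "\<dots> \<le> tail p x"
    unfolding tail_def using assms
    by (intro finite_sum_le_infsum)
      (auto simp: transition_rate_def intro: summable_on_subset_banach[of p UNIV])
  finally show ?thesis .
qed

section \<open>Crude growth of subpolynomial functions\<close>

text \<open>Passing from \<open>z\<close> to \<open>z + 1\<close> costs at most a factor
  \<open>2 * K\<close> once the bound for \<open>\<phi> z\<close> also dominates
  \<open>\<phi> 1\<close>; the extra 1 in the base ensures this by making it at least 1. The
  exponential growth is harmless because the bound is applied only to \<open>z\<close> below a fixed
  threshold.\<close>

lemma subpolynomial_le_power:
  assumes "subpolynomial K \<phi>" "K > 0" "1 \<le> z"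
  shows "\<phi> z \<le> (2 * K + 1) ^ z * \<phi> 1"
  using assms(3)
proof (induction z rule: dec_induct)
  case base
  have "0 \<le> \<phi> 1" using assms(1) by (simp add: subpolynomial_def)
  then show ?case using assms(2) by (simp add: mult_le_cancel_right1)
next
  case (step z)
  have nn: "0 \<le> \<phi> 1" using assms(1) by (simp add: subpolynomial_def)
  have "\<phi> 1 \<le> (2 * K + 1) ^ z * \<phi> 1"
    using nn assms(2) mult_right_mono[OF one_le_power[of "2 * K + 1" z], of "\<phi> 1"] by simp
  moreover have "\<phi> (z + 1) \<le> K * (\<phi> z + \<phi> 1)"
    using assms(1) step.hyps(1) unfolding subpolynomial_def by blast
  ultimately have "\<phi> (Suc z) \<le> K * ((2 * K + 1) ^ z * \<phi> 1 + (2 * K + 1) ^ z * \<phi> 1)"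
    using step.IH assms(2) by (smt (verit) mult_left_mono Suc_eq_plus1)
  also have "\<dots> \<le> (2 * K + 1) ^ Suc z * \<phi> 1"
    using nn assms(2) by (simp add: algebra_simps)
  finally show ?case .
qed

section \<open>Mass of \<open>p\<close> in the shells from \<open>(1 - \<epsilon>) * z\<close> to
  \<open>z\<close>, and averaging over them\<close>

text \<open>A Bernoulli inequality, from \<open>ln (1 - e) \<le> - e\<close> and
  \<open>1 + t \<le> exp t\<close>. It makes the shell mass explicitly linear in
  \<open>\<epsilon>\<close>, which later cancels a factor \<open>\<epsilon>\<close> exactly.\<close>

lemma one_plus_le_powr_minus:
  fixes a e :: real
  assumes "0 < a" "0 < e" "e < 1"
  shows "1 + a * e \<le> (1 - e) powr (- a)"
proof -
  have "ln (1 - e) \<le> - e" using ln_le_minus_one[of "1 - e"] assms by simp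
  then have "a * e \<le> - a * ln (1 - e)"
    using assms mult_left_mono[of "ln (1 - e)" "- e" a] by simp
  then have "exp (a * e) \<le> (1 - e) powr (- a)"
    using assms by (simp add: powr_def)
  then show ?thesis using exp_ge_add_one_self[of "a * e"] by linarith
qed

text \<open>Multiplied by \<open>z powr \<alpha>\<close>, the difference of tails converges to
  \<open>c * ((1 - \<epsilon>) powr (- \<alpha>) - 1)\<close>, which is at least
  \<open>c * \<alpha> * \<epsilon>\<close>; half of that is a strict lower bound for all large
  \<open>z\<close>.\<close>

lemma tail_diff_lower_bound:
  fixes \<alpha> \<epsilon> c :: real
  assumes lim: "((\<lambda>x. x powr \<alpha> * tail p x) \<longlongrightarrow> c) at_top"
    and "0 < \<alpha>" "0 < c" "0 < \<epsilon>" "\<epsilon> < 1"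
  shows "\<exists>N\<ge>1. \<forall>z\<ge>N. c * \<alpha> * \<epsilon> / 2 * real z powr (- \<alpha>) \<le>
    tail p ((1 - \<epsilon>) * real z) - tail p (real z)"
proof -
  have scale: "filterlim (\<lambda>x. (1 - \<epsilon>) * x) at_top at_top"
    using assms by (intro filterlim_tendsto_pos_mult_at_top[OF tendsto_const] filterlim_ident) auto
  \<comment> \<open>The prefactor turns \<open>((1 - \<epsilon>) * x) powr \<alpha>\<close> back
    into \<open>x powr \<alpha>\<close>, so that both tails carry the same weight.\<close>
  have "((\<lambda>x. (1 - \<epsilon>) powr (- \<alpha>) * (((1 - \<epsilon>) * x) powr \<alpha> * tail p ((1 - \<epsilon>) * x))
      - x powr \<alpha> * tail p x) \<longlongrightarrow> (1 - \<epsilon>) powr (- \<alpha>) * c - c) at_top"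
    by (intro tendsto_intros lim filterlim_compose[OF lim scale])
  moreover have "c * \<alpha> * \<epsilon> / 2 < (1 - \<epsilon>) powr (- \<alpha>) * c - c"
  proof -
    have "(1 + \<alpha> * \<epsilon>) * c \<le> (1 - \<epsilon>) powr (- \<alpha>) * c"
      using one_plus_le_powr_minus[of \<alpha> \<epsilon>] assms by (intro mult_right_mono) auto
    moreover have "0 < c * \<alpha> * \<epsilon>" using assms by simp
    ultimately show ?thesis by (simp add: algebra_simps)
  qed
  ultimately have "\<forall>\<^sub>F x in at_top. c * \<alpha> * \<epsilon> / 2 <
      (1 - \<epsilon>) powr (- \<alpha>) * (((1 - \<epsilon>) * x) powr \<alpha> * tail p ((1 - \<epsilon>) * x)) - x powr \<alpha> * tail p x"
    by (rule order_tendstoD(1))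
  then obtain X where X: "\<And>x. x \<ge> X \<Longrightarrow> c * \<alpha> * \<epsilon> / 2 <
      (1 - \<epsilon>) powr (- \<alpha>) * (((1 - \<epsilon>) * x) powr \<alpha> * tail p ((1 - \<epsilon>) * x)) - x powr \<alpha> * tail p x"
    by (auto simp: eventually_at_top_linorder)
  have "c * \<alpha> * \<epsilon> / 2 * real z powr (- \<alpha>) \<le> tail p ((1 - \<epsilon>) * real z) - tail p (real z)"
    if "z \<ge> max 1 (nat \<lceil>X\<rceil>)" for z
  proof -
    have z: "0 < real z" "X \<le> real z" using that by linarith+
    have e: "(1 - \<epsilon>) powr (- \<alpha>) * ((1 - \<epsilon>) * real z) powr \<alpha> = real z powr \<alpha>"
      using assms z by (simp add: powr_mult powr_minus)
    have "c * \<alpha> * \<epsilon> / 2 \<le> real z powr \<alpha> * (tail p ((1 - \<epsilon>) * real z) - tail p (real z))"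
      using X[OF z(2)] by (simp add: e right_diff_distrib flip: mult.assoc)
    then show ?thesis
      using z by (simp add: powr_minus field_simps)
  qed
  then show ?thesis by (intro exI[of _ "max 1 (nat \<lceil>X\<rceil>)"]) auto
qed

text \<open>The constant \<open>D\<close> is \<open>2 / (c \<alpha> \<epsilon>)\<close> below.\<close>

lemma averaging_bound:
  fixes \<alpha> \<epsilon> D K :: real
  assumes p: "transition_rate p" and sub: "subpolynomial K \<phi>"
    and pos: "0 < \<epsilon>" "\<epsilon> \<le> 1 / 2" "0 < D" "0 < K"
    and lower: "real z powr (- \<alpha>) \<le> D * (tail p ((1 - \<epsilon>) * real z) - tail p (real z))"
    and z: "1 \<le> z" "z \<le> n"
  shows "q \<alpha> z * \<phi> z \<le> (\<Sum>x\<in>{x\<in>{1..n}. (1 - \<epsilon>) * real z \<le> real x \<and> x < z}.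
    D * K / real z * p (int x) * (\<phi> x + \<phi> (z - x)))"
proof -
  let ?B = "{x\<in>{1..n}. (1 - \<epsilon>) * real z \<le> real x \<and> x < z}"
  have p0: "0 \<le> p y" for y using p by (simp add: transition_rate_def)
  \<comment> \<open>The lower end of the shell is positive, which excludes \<open>x = 0\<close>, and
    \<open>x < z \<le> n\<close>; hence the shell lies in \<open>{1..n}\<close>.\<close>
  have B: "{x. (1 - \<epsilon>) * real z \<le> real x \<and> x < z} = ?B"
  proof -
    have "0 < (1 - \<epsilon>) * real z" using pos z by simp
    then have "1 \<le> x" if "(1 - \<epsilon>) * real z \<le> real x" for x
      using that by (cases x) auto
    then show ?thesis using z by auto
  qed
  have "(1 - \<epsilon>) * real z \<le> real z" using pos by (simp add: algebra_simps)
  moreover have "0 \<le> (1 - \<epsilon>) * real z" using pos by simp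
  ultimately have mass: "real z powr (- \<alpha>) \<le> D * (\<Sum>x\<in>?B. p (int x))"
    using lower tail_diff[OF p, of "(1 - \<epsilon>) * real z" z] unfolding B by simp
  have phi: "0 \<le> \<phi> z" using sub z by (simp add: subpolynomial_def)
  have "- (1 + \<alpha>) = - \<alpha> - 1" by simp
  then have "q \<alpha> z = real z powr (- \<alpha>) / real z"
    using z by (simp only: q_def powr_diff) simp
  then have "q \<alpha> z * \<phi> z \<le> D * (\<Sum>x\<in>?B. p (int x)) / real z * \<phi> z"
    using mass phi by (intro mult_right_mono) (simp_all add: divide_right_mono)
  also have "\<dots> = (\<Sum>x\<in>?B. D / real z * p (int x) * \<phi> z)"
    by (simp add: sum_distrib_left sum_distrib_right sum_divide_distrib mult_ac)
  also have "\<dots> \<le> (\<Sum>x\<in>?B. D * K / real z * p (int x) * (\<phi> x + \<phi> (z - x)))"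
  proof (rule sum_mono)
    fix x assume x: "x \<in> ?B"
    then have "\<phi> (x + (z - x)) \<le> K * (\<phi> x + \<phi> (z - x))"
      using sub unfolding subpolynomial_def by (metis (no_types, lifting) One_nat_def Suc_leI
        atLeastAtMost_iff mem_Collect_eq zero_less_diff)
    then have "\<phi> z \<le> K * (\<phi> x + \<phi> (z - x))" using x by simp
    then have "D / real z * p (int x) * \<phi> z \<le> D / real z * p (int x) * (K * (\<phi> x + \<phi> (z - x)))"
      using pos p0 by (intro mult_left_mono) auto
    then show "D / real z * p (int x) * \<phi> z \<le> D * K / real z * p (int x) * (\<phi> x + \<phi> (z - x))"
      by (simp add: mult_ac)
  qed
  finally show ?thesis .
qed

section \<open>Exchange of the double sums\<close>

text \<open>For fixed \<open>x\<close>, \<open>\<epsilon> \<le> 1 / 2\<close> forces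
  \<open>x < z \<le> 2 * x\<close>. These are at most \<open>x\<close> values of \<open>z\<close>,
  each with weight at most \<open>1 / x\<close>.\<close>

lemma first_part_bound:
  fixes f :: "nat \<Rightarrow> real" and \<epsilon> :: real
  assumes f: "\<And>x. 1 \<le> x \<Longrightarrow> 0 \<le> f x" and \<epsilon>: "0 < \<epsilon>" "\<epsilon> \<le> 1 / 2"
  shows "(\<Sum>z=1..n. \<Sum>x\<in>{x\<in>{1..n}. (1 - \<epsilon>) * real z \<le> real x \<and> x < z}. f x / real z)
    \<le> (\<Sum>x=1..n. f x)"
proof -
  have "(\<Sum>z=1..n. \<Sum>x\<in>{x\<in>{1..n}. (1 - \<epsilon>) * real z \<le> real x \<and> x < z}. f x / real z)
    = (\<Sum>x=1..n. \<Sum>z\<in>{z\<in>{1..n}. (1 - \<epsilon>) * real z \<le> real x \<and> x < z}. f x / real z)"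
    by (rule sum.swap_restrict) auto
  also have "\<dots> \<le> (\<Sum>x=1..n. f x)"
  proof (rule sum_mono)
    fix x assume x: "x \<in> {1..n}"
    let ?Z = "{z\<in>{1..n}. (1 - \<epsilon>) * real z \<le> real x \<and> x < z}"
    have Z: "?Z \<subseteq> {x<..2 * x}"
    proof
      fix z assume z: "z \<in> ?Z"
      have "1 / 2 * real z \<le> (1 - \<epsilon>) * real z" using \<epsilon> by (intro mult_right_mono) auto
      moreover have "(1 - \<epsilon>) * real z \<le> real x" using z by simp
      ultimately have "real z \<le> 2 * real x" by linarith
      then show "z \<in> {x<..2 * x}" using z by simp
    qed
    have "(\<Sum>z\<in>?Z. f x / real z) \<le> (\<Sum>z\<in>{x<..2 * x}. f x / real z)"
      using f x Z by (intro sum_mono2) auto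
    also have "\<dots> \<le> (\<Sum>z\<in>{x<..2 * x}. f x / real x)"
      using f x by (intro sum_mono divide_left_mono) auto
    also have "\<dots> = f x" using x by simp
    finally show "(\<Sum>z\<in>?Z. f x / real z) \<le> f x" .
  qed
  finally show ?thesis .
qed

text \<open>Put \<open>w = z - x\<close>. Then \<open>w \<le> \<epsilon> * z\<close> gives
  \<open>1 / z \<le> \<epsilon> / w\<close>, and \<open>z \<le> 2 * x\<close> gives
  \<open>x \<ge> w / (2 * \<epsilon>)\<close>. For fixed \<open>w\<close> the remaining sum over
  \<open>x\<close> is part of a tail starting far out.\<close>

lemma second_part_bound:
  fixes \<phi> :: "nat \<Rightarrow> real" and \<epsilon> :: real
  assumes p: "transition_rate p" and \<phi>: "\<And>x. 1 \<le> x \<Longrightarrow> 0 \<le> \<phi> x"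
    and \<epsilon>: "0 < \<epsilon>" "\<epsilon> \<le> 1 / 2"
  shows "(\<Sum>z=1..n. \<Sum>x\<in>{x\<in>{1..n}. (1 - \<epsilon>) * real z \<le> real x \<and> x < z}.
      p (int x) * \<phi> (z - x) / real z)
    \<le> (\<Sum>w=1..n. \<epsilon> / real w * tail p (real w / (2 * \<epsilon>)) * \<phi> w)"
proof -
  have p0: "0 \<le> p y" for y using p by (simp add: transition_rate_def)
  have "(\<Sum>z=1..n. \<Sum>x\<in>{x\<in>{1..n}. (1 - \<epsilon>) * real z \<le> real x \<and> x < z}.
      p (int x) * \<phi> (z - x) / real z)
    = (\<Sum>x=1..n. \<Sum>z\<in>{z\<in>{1..n}. (1 - \<epsilon>) * real z \<le> real x \<and> x < z}.
      p (int x) * \<phi> (z - x) / real z)"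
    by (rule sum.swap_restrict) auto
  also have "\<dots> \<le> (\<Sum>x=1..n. \<Sum>w\<in>{w\<in>{1..n}. real w / (2 * \<epsilon>) \<le> real x}.
      p (int x) * \<phi> w * (\<epsilon> / real w))"
  proof (rule sum_mono)
    fix x assume x: "x \<in> {1..n}"
    let ?Z = "{z\<in>{1..n}. (1 - \<epsilon>) * real z \<le> real x \<and> x < z}"
    let ?W = "{w\<in>{1..n}. real w / (2 * \<epsilon>) \<le> real x}"
    have in_W: "z - x \<in> ?W \<and> 1 / real z \<le> \<epsilon> / real (z - x)" if z: "z \<in> ?Z" for z
    proof -
      have w: "real (z - x) = real z - real x" "1 \<le> z - x" using z by auto
      then have small: "real (z - x) \<le> \<epsilon> * real z" using z by (simp add: algebra_simps)
      have "1 / 2 * real z \<le> (1 - \<epsilon>) * real z" using \<epsilon> by (intro mult_right_mono) auto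
      moreover have "(1 - \<epsilon>) * real z \<le> real x" using z by simp
      ultimately have "real z \<le> 2 * real x" by linarith
      then have "\<epsilon> * real z \<le> \<epsilon> * (2 * real x)" using \<epsilon> by (intro mult_left_mono) auto
      then have "real (z - x) \<le> real x * (2 * \<epsilon>)" using small by (simp add: mult_ac)
      then have "real (z - x) / (2 * \<epsilon>) \<le> real x"
        using \<epsilon> by (simp add: pos_divide_le_eq)
      moreover have "1 / real z \<le> \<epsilon> / real (z - x)"
        using small w(2) z by (simp add: frac_le_eq field_simps del: of_nat_diff)
      ultimately show ?thesis using w z by auto
    qed
    have "(\<Sum>z\<in>?Z. p (int x) * \<phi> (z - x) / real z)
        \<le> (\<Sum>z\<in>?Z. p (int x) * \<phi> (z - x) * (\<epsilon> / real (z - x)))"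
    proof (rule sum_mono)
      fix z assume z: "z \<in> ?Z"
      then have "p (int x) * \<phi> (z - x) * (1 / real z)
          \<le> p (int x) * \<phi> (z - x) * (\<epsilon> / real (z - x))"
        using in_W[OF z] \<phi>[of "z - x"] p0 by (intro mult_left_mono) auto
      then show "p (int x) * \<phi> (z - x) / real z \<le> p (int x) * \<phi> (z - x) * (\<epsilon> / real (z - x))"
        by simp
    qed
    \<comment> \<open>Truncated subtraction is injective here because \<open>x < z\<close> on
      \<open>?Z\<close>.\<close>
    also have "\<dots> = (\<Sum>w\<in>(\<lambda>z. z - x) ` ?Z. p (int x) * \<phi> w * (\<epsilon> / real w))"
      by (subst sum.reindex) (auto simp: inj_on_def)
    also have "\<dots> \<le> (\<Sum>w\<in>?W. p (int x) * \<phi> w * (\<epsilon> / real w))"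
      using in_W \<phi> p0 \<epsilon> by (intro sum_mono2) auto
    finally show "(\<Sum>z\<in>?Z. p (int x) * \<phi> (z - x) / real z)
      \<le> (\<Sum>w\<in>?W. p (int x) * \<phi> w * (\<epsilon> / real w))" .
  qed
  also have "\<dots> = (\<Sum>w=1..n. \<Sum>x\<in>{x\<in>{1..n}. real w / (2 * \<epsilon>) \<le> real x}.
      p (int x) * \<phi> w * (\<epsilon> / real w))"
    by (rule sum.swap_restrict) auto
  also have "\<dots> = (\<Sum>w=1..n. \<epsilon> / real w *
      (\<Sum>x\<in>{x\<in>{1..n}. real w / (2 * \<epsilon>) \<le> real x}. p (int x)) * \<phi> w)"
    by (simp add: sum_distrib_left sum_distrib_right mult_ac)
  also have "\<dots> \<le> (\<Sum>w=1..n. \<epsilon> / real w * tail p (real w / (2 * \<epsilon>)) * \<phi> w)"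
    using \<epsilon> \<phi> p by (intro sum_mono mult_right_mono mult_left_mono sum_le_tail) auto
  finally show ?thesis .
qed

section \<open>Choice of constants and absorption\<close>

text \<open>The two factors \<open>\<epsilon>\<close> cancel, and the tail is at most
  \<open>2 * c * (2 * \<epsilon>) powr \<alpha> * w powr (- \<alpha>)\<close>. The 8 in the
  condition on \<open>\<epsilon>\<close> makes the resulting coefficient of
  \<open>q \<alpha> w\<close> exactly one half.\<close>

lemma scaled_tail_bound:
  fixes \<alpha> \<epsilon> c K X :: real
  assumes upper: "\<And>x. X \<le> x \<Longrightarrow> x powr \<alpha> * tail p x \<le> 2 * c"
    and pos: "0 < \<alpha>" "0 < c" "0 < K" "0 < \<epsilon>"
    and \<epsilon>: "X \<le> 1 / (2 * \<epsilon>)" "(2 * \<epsilon>) powr \<alpha> \<le> \<alpha> / (8 * K)"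
    and w: "1 \<le> w"
  shows "2 / (c * \<alpha> * \<epsilon>) * K * (\<epsilon> / real w * tail p (real w / (2 * \<epsilon>))) \<le> q \<alpha> w / 2"
proof -
  have w0: "0 < real w" using w by simp
  have "1 / (2 * \<epsilon>) \<le> real w / (2 * \<epsilon>)"
    using w pos by (intro divide_right_mono) auto
  then have "(real w / (2 * \<epsilon>)) powr \<alpha> * tail p (real w / (2 * \<epsilon>)) \<le> 2 * c"
    using \<epsilon>(1) by (intro upper) linarith
  then have "tail p (real w / (2 * \<epsilon>)) \<le> 2 * c * ((2 * \<epsilon>) powr \<alpha> / real w powr \<alpha>)"
    using w0 pos by (simp add: powr_divide field_simps)
  also have "\<dots> \<le> 2 * c * (\<alpha> / (8 * K) / real w powr \<alpha>)"
    using \<epsilon>(2) pos by (intro mult_left_mono divide_right_mono) auto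
  finally have "2 / (c * \<alpha> * \<epsilon>) * K * (\<epsilon> / real w * tail p (real w / (2 * \<epsilon>)))
      \<le> 2 / (c * \<alpha> * \<epsilon>) * K * (\<epsilon> / real w * (2 * c * (\<alpha> / (8 * K) / real w powr \<alpha>)))"
    using pos by (intro mult_left_mono) auto
  also have "\<dots> = q \<alpha> w / 2"
    using pos w0 by (simp add: q_def powr_diff powr_minus powr_add field_simps)
  finally show ?thesis .
qed

theorem theorem2p1:
  fixes \<alpha> :: real and p :: "int \<Rightarrow> real"
  assumes "0 < \<alpha>" and "\<alpha> < 2"
    and "transition_rate p" and "symmetric_rate p"
    and "p \<in> DAN \<alpha>" and "p 1 > 0"
  shows "\<forall>K::real. K > 0 \<longrightarrow>
    (\<exists>\<kappa>::real. \<forall>\<phi> :: nat \<Rightarrow> real. subpolynomial K \<phi> \<longrightarrow>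
      (\<forall>n::nat. 1 \<le> n \<longrightarrow>
        (\<Sum>z=1..n. q \<alpha> z * \<phi> z) \<le> \<kappa> * (\<Sum>z=1..n. p (int z) * \<phi> z)))"
proof (intro allI impI)
  fix K :: real assume K: "K > 0"
  have p0: "0 \<le> p y" for y using assms(3) by (simp add: transition_rate_def)
  obtain c where c: "c > 0" and lim: "((\<lambda>x. x powr \<alpha> * tail p x) \<longlongrightarrow> c) at_top"
    using assms(5) by (auto simp: DAN_def tail_def)
  have "\<forall>\<^sub>F x in at_top. x powr \<alpha> * tail p x < 2 * c"
    using c by (intro order_tendstoD(2)[OF lim]) simp
  then obtain X where X: "\<And>x. X \<le> x \<Longrightarrow> x powr \<alpha> * tail p x \<le> 2 * c"
    by (auto simp: eventually_at_top_linorder intro: less_imp_le)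
  \<comment> \<open>\<open>Y\<close> is \<open>1 / (2 * \<epsilon>)\<close>. Its three lower bounds
    give, in order, \<open>\<epsilon> \<le> 1 / 2\<close>, the tail estimate at every
    \<open>w / (2 * \<epsilon>)\<close> with \<open>w \<ge> 1\<close>, and
    \<open>(2 * \<epsilon>) powr \<alpha> \<le> \<alpha> / (8 * K)\<close>.\<close>
  define Y where "Y = Max {1, X, (8 * K / \<alpha>) powr (1 / \<alpha>)}"
  define \<epsilon> where "\<epsilon> = 1 / (2 * Y)"
  have Y: "1 \<le> Y" "X \<le> Y" "(8 * K / \<alpha>) powr (1 / \<alpha>) \<le> Y" by (auto simp: Y_def)
  have \<epsilon>: "0 < \<epsilon>" "\<epsilon> \<le> 1 / 2" "X \<le> 1 / (2 * \<epsilon>)"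
    using Y by (auto simp: \<epsilon>_def field_simps)
  have \<epsilon>_powr: "(2 * \<epsilon>) powr \<alpha> \<le> \<alpha> / (8 * K)"
  proof -
    have "((8 * K / \<alpha>) powr (1 / \<alpha>)) powr \<alpha> \<le> Y powr \<alpha>"
      using Y assms(1) by (intro powr_mono2) auto
    then have "8 * K / \<alpha> \<le> Y powr \<alpha>" using K assms(1) by (simp add: powr_powr)
    then have "1 / Y powr \<alpha> \<le> 1 / (8 * K / \<alpha>)"
      using K assms(1) by (intro frac_le) auto
    then show ?thesis using Y by (simp add: \<epsilon>_def powr_divide)
  qed
  define D where "D = 2 / (c * \<alpha> * \<epsilon>)"
  have D: "0 < D" using c assms(1) \<epsilon> by (simp add: D_def)
  obtain N where N: "N \<ge> 1" "\<And>z. z \<ge> N \<Longrightarrow> c * \<alpha> * \<epsilon> / 2 * real z powr (- \<alpha>) \<le>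
      tail p ((1 - \<epsilon>) * real z) - tail p (real z)"
    using tail_diff_lower_bound[OF lim, of \<epsilon>] assms(1) c \<epsilon> by fastforce
  define M where "M = (\<Sum>z=1..N. q \<alpha> z * (2 * K + 1) ^ z)"
  have q0: "0 \<le> q \<alpha> z" for z by (simp add: q_def)
  have M0: "0 \<le> M" using K q0 by (auto simp: M_def intro!: sum_nonneg)
  show "\<exists>\<kappa>. \<forall>\<phi>. subpolynomial K \<phi> \<longrightarrow> (\<forall>n\<ge>1.
      (\<Sum>z=1..n. q \<alpha> z * \<phi> z) \<le> \<kappa> * (\<Sum>z=1..n. p (int z) * \<phi> z))"
  \<comment> \<open>The witness stays schematic until the last \<open>show\<close>, where it becomes
    \<open>2 * (M / p 1 + D * K)\<close>; all constants in it were fixed before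
    \<open>\<phi>\<close> and \<open>n\<close>.\<close>
  proof (intro exI allI impI)
    fix \<phi> :: "nat \<Rightarrow> real" and n :: nat
    assume sub: "subpolynomial K \<phi>" and n: "1 \<le> n"
    have \<phi>0: "0 \<le> \<phi> x" if "1 \<le> x" for x using sub that by (simp add: subpolynomial_def)
    define S where "S = (\<Sum>z=1..n. q \<alpha> z * \<phi> z)"
    define R where "R = (\<Sum>z=1..n. p (int z) * \<phi> z)"
    let ?B = "\<lambda>z. {x\<in>{1..n}. (1 - \<epsilon>) * real z \<le> real x \<and> x < z}"
    define U where "U = (\<Sum>z=1..n. \<Sum>x\<in>?B z. p (int x) * \<phi> x / real z)"
    define V where "V = (\<Sum>z=1..n. \<Sum>x\<in>?B z. p (int x) * \<phi> (z - x) / real z)"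
    have large: "q \<alpha> z * \<phi> z \<le> (\<Sum>x\<in>?B z. D * K / real z * p (int x) * (\<phi> x + \<phi> (z - x)))"
      if z: "N \<le> z" "z \<le> n" for z
    proof (rule averaging_bound[OF assms(3) sub \<epsilon>(1,2) D K])
      have "D * (c * \<alpha> * \<epsilon> / 2 * real z powr (- \<alpha>))
          \<le> D * (tail p ((1 - \<epsilon>) * real z) - tail p (real z))"
        using N(2)[OF z(1)] D by (intro mult_left_mono) auto
      then show "real z powr (- \<alpha>) \<le> D * (tail p ((1 - \<epsilon>) * real z) - tail p (real z))"
        using c assms(1) \<epsilon> by (simp add: D_def)
    qed (use N z in auto)
    have R1: "p 1 * \<phi> 1 \<le> R"
      using member_le_sum[of 1 "{1..n}" "\<lambda>z. p (int z) * \<phi> z"] n p0 \<phi>0 by (simp add: R_def)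
    \<comment> \<open>The shell sum is nonnegative, so it may be kept for \<open>z \<le> N\<close>
      too; thus \<open>U\<close> and \<open>V\<close> run over all of \<open>{1..n}\<close>.\<close>
    have "S \<le> (\<Sum>z=1..n. (if z \<le> N then q \<alpha> z * ((2 * K + 1) ^ z * \<phi> 1) else 0)
        + (\<Sum>x\<in>?B z. D * K / real z * p (int x) * (\<phi> x + \<phi> (z - x))))"
      unfolding S_def
    proof (rule sum_mono)
      fix z assume z: "z \<in> {1..n}"
      have nn: "0 \<le> (\<Sum>x\<in>?B z. D * K / real z * p (int x) * (\<phi> x + \<phi> (z - x)))"
        using D K p0 \<phi>0 by (intro sum_nonneg mult_nonneg_nonneg add_nonneg_nonneg) auto
      show "q \<alpha> z * \<phi> z \<le> (if z \<le> N then q \<alpha> z * ((2 * K + 1) ^ z * \<phi> 1) else 0)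
        + (\<Sum>x\<in>?B z. D * K / real z * p (int x) * (\<phi> x + \<phi> (z - x)))"
      proof (cases "z \<le> N")
        case True
        have "q \<alpha> z * \<phi> z \<le> q \<alpha> z * ((2 * K + 1) ^ z * \<phi> 1)"
          using subpolynomial_le_power[OF sub K] z q0 by (intro mult_left_mono) auto
        then show ?thesis using nn True by simp
      qed (use large[of z] z in simp)
    qed
    also have "\<dots> = (\<Sum>z=1..n. if z \<le> N then q \<alpha> z * ((2 * K + 1) ^ z * \<phi> 1) else 0)
        + D * K * (U + V)"
      by (simp add: sum.distrib U_def V_def sum_distrib_left distrib_left add_divide_distrib mult_ac)
    also have "(\<Sum>z=1..n. if z \<le> N then q \<alpha> z * ((2 * K + 1) ^ z * \<phi> 1) else 0) \<le> M * \<phi> 1"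
    proof -
      have "(\<Sum>z=1..n. if z \<le> N then q \<alpha> z * ((2 * K + 1) ^ z * \<phi> 1) else 0)
          = (\<Sum>z\<in>{z\<in>{1..n}. z \<le> N}. q \<alpha> z * ((2 * K + 1) ^ z * \<phi> 1))"
        by (rule sum.inter_filter[symmetric]) simp
      also have "\<dots> \<le> (\<Sum>z=1..N. q \<alpha> z * ((2 * K + 1) ^ z * \<phi> 1))"
        using K q0 \<phi>0 by (intro sum_mono2) auto
      also have "\<dots> = M * \<phi> 1"
        unfolding M_def sum_distrib_right by (simp add: mult_ac)
      finally show ?thesis .
    qed
    also have "M * \<phi> 1 \<le> M / p 1 * R"
      using mult_left_mono[OF R1 M0] assms(6) by (simp add: field_simps)
    finally have main: "S \<le> M / p 1 * R + D * K * U + D * K * V"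
      by (simp add: distrib_left)
    have "U \<le> R"
      unfolding U_def R_def by (rule first_part_bound) (use \<epsilon> p0 \<phi>0 in auto)
    then have DU: "D * K * U \<le> D * K * R" using D K by (intro mult_left_mono) auto
    have "V \<le> (\<Sum>w=1..n. \<epsilon> / real w * tail p (real w / (2 * \<epsilon>)) * \<phi> w)"
      unfolding V_def by (rule second_part_bound[OF assms(3) \<phi>0 \<epsilon>(1,2)])
    then have "D * K * V \<le> D * K * (\<Sum>w=1..n. \<epsilon> / real w * tail p (real w / (2 * \<epsilon>)) * \<phi> w)"
      using D K by (intro mult_left_mono) auto
    also have "\<dots> = (\<Sum>w=1..n. D * K * (\<epsilon> / real w * tail p (real w / (2 * \<epsilon>))) * \<phi> w)"
      by (simp add: sum_distrib_left mult_ac)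
    also have "\<dots> \<le> (\<Sum>w=1..n. q \<alpha> w / 2 * \<phi> w)"
      unfolding D_def using scaled_tail_bound[OF X assms(1) c K \<epsilon>(1,3) \<epsilon>_powr] \<phi>0
      by (intro sum_mono mult_right_mono) auto
    also have "\<dots> = S / 2" by (simp add: S_def sum_divide_distrib)
    \<comment> \<open>The \<open>V\<close> part is at most \<open>S / 2\<close>; as \<open>S\<close>
      is a finite sum, it can be moved to the left, which doubles the constant.\<close>
    finally have "S \<le> 2 * (M / p 1 * R + D * K * R)"
      using main DU by argo
    then have "S \<le> 2 * (M / p 1 + D * K) * R" by (simp add: distrib_right)
    then show "(\<Sum>z=1..n. q \<alpha> z * \<phi> z) \<le> 2 * (M / p 1 + D * K) * (\<Sum>z=1..n. p (int z) * \<phi> z)"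
      by (simp add: S_def R_def)
  qed
qed

end
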